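(* Let $H=H_n$ be an arbitrary sequence of graphs with $v(H_n)\le n$ and at least one edge. Let $p=p_n\in[0,1]$ satisfy $$\liminf_{q\downarrow0}\ \liminf_{n\to\infty}\ \frac{p_n}{\psi_q(H_n)/q}\ \ge\ 3 .$$ Then the model of $H_n$ planted in $G(n,p_n)$ is in the "nothing" regime, that is, $\lim_{n\to\infty}\mathrm{MMSE}_n(p_n)/e(H_n)=1$.
   Context: Graphs: $v(J)$ is the number of vertices of $J$; $|J|=e(J)$ is the number of edges. $K_n$ is the complete graph on $n$ vertices. Graphs in $K_n$ are identified with vectors in $\{0,1\}^{\binom n2}$ (edge indicators). Planted model: given $H=H_n$ with $v(H)\le n$, let $\mathcal S$ be the set of copies of $H$ in $K_n$ and $\mathbf P$ the uniform measure on $\mathcal S$. Under $\mathbb P_p$, one observes $\mathbf Y=\mathbf H\cup\mathbf G$, where $\mathbf H\sim\mathbf P$ and $\mathbf G\sim G(n,p)$ is independent of $\mathbf H$. Set $\mathrm{MMSE}_n(p)=\mathbb E_{\mathbb P_p}\big[\|\mathbf H-\mathbb E[\mathbf H\mid\mathbf Y]\|_2^2\big]\in[0,e(H)]$. Thresholds: for a graph $J$ with at least one edge, $M_J=\frac{n!/(n-v(J))!}{|\mathrm{Aut}(J)|}$ is the number of copies of $J$ in $K_n$, and the first moment threshold is $p_{1M}(J)=M_J^{-1/e(J)}$. For $q\in[0,1]$, $\psi_q(H)=\max\{p_{1M}(J): J\subseteq H,\ |J|\ge\max\{1,q|H|\}\}$. *)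

theory Defs
  imports "HOL-Probability.Probability" "HOL-Combinatorics.Permutations"
begin

datatype 'a graph = Graph (verts: "'a set") (edges: "'a set set")

definition simple_graph :: "'a graph \<Rightarrow> bool" where
  "simple_graph G \<longleftrightarrow> finite (verts G) \<and> edges G \<subseteq> {e. e \<subseteq> verts G \<and> card e = 2}"

abbreviation num_verts :: "'a graph \<Rightarrow> nat" where
  "num_verts G \<equiv> card (verts G)"

abbreviation num_edges :: "'a graph \<Rightarrow> nat" where
  "num_edges G \<equiv> card (edges G)"

definition is_subgraph :: "'a graph \<Rightarrow> 'a graph \<Rightarrow> bool" where
  "is_subgraph J G \<longleftrightarrow> simple_graph J \<and> verts J \<subseteq> verts G \<and> edges J \<subseteq> edges G"

definition isomorphic :: "'a graph \<Rightarrow> 'b graph \<Rightarrow> bool" where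
  "isomorphic G G' \<longleftrightarrow>
     (\<exists>f. bij_betw f (verts G) (verts G') \<and> (\<lambda>e. f ` e) ` edges G = edges G')"

definition complete_graph :: "nat \<Rightarrow> nat graph" where
  "complete_graph n = Graph {..<n} {e. e \<subseteq> {..<n} \<and> card e = 2}"

(* A copy carries its vertex set, so isolated vertices of H count. This is the convention under
   which the number of copies is (n)_v / |Aut|. Every edge set of a copy extends to the
   same number of copies, so the edge set of a uniform copy is uniform as well. *)
definition copies :: "nat \<Rightarrow> 'a graph \<Rightarrow> nat graph set" where
  "copies n H = {S. is_subgraph S (complete_graph n) \<and> isomorphic H S}"

(* "permutes" makes automorphisms the identity outside the vertex set, so that each
   automorphism is represented by exactly one function. *)
definition Aut :: "'a graph \<Rightarrow> ('a \<Rightarrow> 'a) set" where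
  "Aut G = {f. f permutes verts G \<and> (\<lambda>e. f ` e) ` edges G = edges G}"

definition num_copies :: "nat \<Rightarrow> 'a graph \<Rightarrow> real" where
  "num_copies n J = (fact n / fact (n - num_verts J)) / real (card (Aut J))"

definition p_1M :: "nat \<Rightarrow> 'a graph \<Rightarrow> real" where
  "p_1M n J = num_copies n J powr (- 1 / real (num_edges J))"

definition psi :: "nat \<Rightarrow> real \<Rightarrow> 'a graph \<Rightarrow> real" where
  "psi n q H = Max {p_1M n J | J. is_subgraph J H \<and>
                      real (num_edges J) \<ge> max 1 (q * real (num_edges H))}"

definition gnp :: "nat \<Rightarrow> real \<Rightarrow> nat set set pmf" where
  "gnp n p = map_pmf (\<lambda>b. {e \<in> edges (complete_graph n). b e})
     (Pi_pmf (edges (complete_graph n)) False (\<lambda>_. bernoulli_pmf p))"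

(* Joint law of the planted copy and the independent noise graph. *)
definition planted_model :: "nat \<Rightarrow> 'a graph \<Rightarrow> real \<Rightarrow> (nat graph \<times> nat set set) pmf" where
  "planted_model n H p = pair_pmf (pmf_of_set (copies n H)) (gnp n p)"

definition planted :: "nat graph \<times> nat set set \<Rightarrow> nat set set" where
  "planted \<omega> = edges (fst \<omega>)"

definition observed :: "nat graph \<times> nat set set \<Rightarrow> nat set set" where
  "observed \<omega> = planted \<omega> \<union> snd \<omega>"

definition sigma_observed :: "(nat graph \<times> nat set set) measure" where
  "sigma_observed = vimage_algebra UNIV observed (count_space UNIV)"

(* The squared Euclidean norm and the conditional expectation of the edge-indicator vector
   are written out over the coordinates, which are the edges of the complete graph. *)
definition MMSE :: "nat \<Rightarrow> 'a graph \<Rightarrow> real \<Rightarrow> real" where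
  "MMSE n H p = measure_pmf.expectation (planted_model n H p)
     (\<lambda>\<omega>. \<Sum>e\<in>edges (complete_graph n).
        (of_bool (e \<in> planted \<omega>)
         - real_cond_exp (measure_pmf (planted_model n H p)) sigma_observed
             (\<lambda>\<omega>'. of_bool (e \<in> planted \<omega>')) \<omega>)\<^sup>2)"

end

theory Submission
  imports Defs
begin

text \<open>
  Write \<open>h\<close> for the number of edges of \<open>H\<close>, \<open>M\<close> for the number of its copies in \<open>K\<^sub>n\<close>, and \<open>Y\<close>
  for the observed graph. All copies have \<open>h\<close> edges, so given \<open>Y\<close> the posterior is uniform on
  the copies contained in \<open>Y\<close>. Hence \<open>h - MMSE\<close> is the mean overlap of the planted copy with an
  independent posterior sample (\<open>num_edges_minus_MMSE\<close>), and the task is to show that this overlap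
  is \<open>o(h)\<close>.

  Let \<open>Z\<close> be the number of copies in \<open>Y\<close> and \<open>B\<close> the number of ordered pairs of copies in \<open>Y\<close> that
  share at least \<open>q h\<close> edges. The posterior probability of a large overlap is, on average over the
  planted copy, \<open>B / Z\<^sup>2\<close>. The planted law has density \<open>Z / E Z\<close> with respect to \<open>G(n,p)\<close>, so the
  expectation of \<open>B / Z\<^sup>2\<close> under the planted law is that of \<open>(B / Z) / E Z\<close> under \<open>G(n,p)\<close>. As \<open>B \<le> Z\<^sup>2\<close>, we have
  \<open>B / Z \<le> sqrt B\<close>, and Cauchy-Schwarz bounds the result by \<open>sqrt (E B) / E Z\<close>. No lower tail of
  \<open>Z\<close> has to be controlled. The square of this bound is the part of the second moment ratio that comes
  from large overlaps, \<open>M\<^sup>-\<^sup>2 \<Sum> p\<^sup>-\<^sup>k\<close>, summed over pairs of copies with overlap \<open>k \<ge> q h\<close>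
  (\<open>num_edges_minus_MMSE_le\<close>).

  The threshold \<open>\<psi>\<^sub>q = psi n q H\<close> enters through the probability that a uniform copy contains a
  given set \<open>E\<close> of \<open>k\<close> edges. A uniform copy is the image of a fixed one under a uniform permutation
  of the vertices, and a given \<open>k\<close>-edge subgraph \<open>J\<close> is moved onto \<open>E\<close> with probability at most
  \<open>1 / M\<^sub>J \<le> \<psi>\<^sup>k\<close>. A union bound over the subgraphs gives \<open>(h choose k) \<psi>\<^sup>k\<close>
  (\<open>copies_spread\<close>), and a union bound over \<open>E\<close> then bounds the moment by
  \<open>\<Sum>\<^sub>k (h choose k)\<^sup>2 (\<psi>/p)\<^sup>k\<close>. The binomials are affordable: for \<open>q = 1/m\<close> and
  \<open>k \<ge> h/m\<close> they contribute at most \<open>4\<^sup>h \<le> (4\<^sup>m)\<^sup>k\<close> (\<open>overlap_moment_le\<close>).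

  It remains that \<open>4\<^sup>m \<psi>/p\<close> is small for every fixed \<open>m\<close>. The spread bound for overlaps of size at
  least \<open>h/m\<close> may be used with \<open>\<psi>\<^sub>q\<close> for any \<open>q \<le> 1/m\<close>, and the hypothesis gives
  \<open>\<psi>\<^sub>q/p < q/2\<close> for all small \<open>q\<close> and large \<open>n\<close>. So \<open>q\<close> is taken small
  depending on \<open>m\<close>.
\<close>

section \<open>Automorphisms and vertex permutations\<close>

text \<open>The threshold is applied to graphs without isolated vertices, which are determined by their edges.\<close>
definition spanned :: "'a set set \<Rightarrow> 'a graph" where
  "spanned F = Graph (\<Union>F) F"

definition relabel :: "('a \<Rightarrow> 'b) \<Rightarrow> 'a graph \<Rightarrow> 'b graph" where
  "relabel f G = Graph (f ` verts G) ((\<lambda>e. f ` e) ` edges G)"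

lemma relabel_sel [simp]:
  "verts (relabel f G) = f ` verts G" "edges (relabel f G) = (\<lambda>e. f ` e) ` edges G"
  by (simp_all add: relabel_def)

lemma relabel_comp: "relabel (g \<circ> f) G = relabel g (relabel f G)"
  by (simp add: relabel_def image_image image_comp[symmetric])

lemma relabel_id [simp]: "relabel id G = G"
  by (simp add: relabel_def)

text \<open>Conjugation by an isomorphism maps automorphisms to automorphisms injectively. It is needed because
  \<open>psi\<close> ranges over subgraphs of \<open>H\<close>, whereas permutations act on \<open>{..<n}\<close>.\<close>

lemma card_Aut_le:
  assumes f: "bij_betw f (verts G) (verts G')" and E: "(\<lambda>e. f ` e) ` edges G = edges G'"
    and sub: "\<And>e. e \<in> edges G \<Longrightarrow> e \<subseteq> verts G" and fin: "finite (verts G)"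
  shows "card (Aut G') \<le> card (Aut G)"
proof (rule card_inj_on_le)
  define g where "g = inv_into (verts G) f"
  define c where "c = (\<lambda>\<tau> x. if x \<in> verts G then g (\<tau> (f x)) else x)"
  have g: "bij_betw g (verts G') (verts G)"
    unfolding g_def by (rule bij_betw_inv_into[OF f])
  have gf: "g (f x) = x" if "x \<in> verts G" for x
    using f that by (simp add: g_def bij_betw_def inv_into_f_f)
  have fg: "f (g y) = y" if "y \<in> verts G'" for y
    using f that by (simp add: g_def bij_betw_def f_inv_into_f)
  have fin_V: "f x \<in> verts G'" if "x \<in> verts G" for x
    using f that by (auto simp: bij_betw_def)
  have f_edge: "f ` e \<in> edges G'" if "e \<in> edges G" for e using E that by auto
  have g_edge: "g ` e \<in> edges G" if "e \<in> edges G'" for e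
  proof -
    obtain e' where e': "e' \<in> edges G" "e = f ` e'" using E \<open>e \<in> edges G'\<close> by blast
    have "g ` e = e'" using sub[OF e'(1)] gf unfolding e'(2) by force
    then show ?thesis using e' by simp
  qed
  have fin_E: "finite (edges G)"
    by (rule finite_subset[of _ "Pow (verts G)"]) (use sub fin in auto)
  show "inj_on c (Aut G')"
  proof (rule inj_onI, rule ext)
    fix \<tau> \<rho> y assume \<tau>: "\<tau> \<in> Aut G'" and \<rho>: "\<rho> \<in> Aut G'" and eq: "c \<tau> = c \<rho>"
    have p: "\<tau> permutes verts G'" "\<rho> permutes verts G'" using \<tau> \<rho> by (auto simp: Aut_def)
    show "\<tau> y = \<rho> y"
    proof (cases "y \<in> verts G'")
      case True
      then have gy: "g y \<in> verts G" using g by (auto simp: bij_betw_def)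
      have "g (\<tau> y) = g (\<rho> y)"
        using fun_cong[OF eq, of "g y"] gy fg[OF True] by (simp add: c_def)
      moreover have "\<tau> y \<in> verts G'" "\<rho> y \<in> verts G'"
        using permutes_in_image[OF p(1)] permutes_in_image[OF p(2)] True by auto
      ultimately show ?thesis using fg by metis
    next
      case False
      then show ?thesis using p by (simp add: permutes_def)
    qed
  qed
  show "c ` Aut G' \<subseteq> Aut G"
  proof
    fix \<sigma> assume "\<sigma> \<in> c ` Aut G'"
    then obtain \<tau> where \<tau>: "\<tau> permutes verts G'" "(\<lambda>e. \<tau> ` e) ` edges G' = edges G'" "\<sigma> = c \<tau>"
      by (auto simp: Aut_def)
    have "bij_betw (g \<circ> \<tau> \<circ> f) (verts G) (verts G)"
      using f g permutes_imp_bij[OF \<tau>(1)] by (auto intro: bij_betw_trans)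
    then have "bij_betw \<sigma> (verts G) (verts G)"
      by (rule bij_betw_cong[THEN iffD1, rotated]) (simp add: \<tau>(3) c_def)
    then have perm: "\<sigma> permutes verts G"
      by (rule bij_imp_permutes) (simp add: \<tau>(3) c_def)
    have "\<sigma> ` e = g ` \<tau> ` f ` e" if "e \<in> edges G" for e
      using sub[OF that] by (auto simp: \<tau>(3) c_def image_image intro!: image_cong)
    moreover have "\<tau> ` f ` e \<in> edges G'" if "e \<in> edges G" for e
      using f_edge[OF that] \<tau>(2) by blast
    ultimately have "(\<lambda>e. \<sigma> ` e) ` edges G \<subseteq> edges G"
      using g_edge by auto
    moreover have "inj_on (\<lambda>e. \<sigma> ` e) (edges G)"
      using permutes_inj[OF perm] by (auto intro: inj_onI simp: inj_image_eq_iff)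
    ultimately have "(\<lambda>e. \<sigma> ` e) ` edges G = edges G"
      using fin_E by (simp add: endo_inj_surj)
    then show "\<sigma> \<in> Aut G" using perm by (simp add: Aut_def)
  qed
  show "finite (Aut G)"
    by (rule finite_subset[OF _ finite_permutations[OF fin]]) (auto simp: Aut_def)
qed

text \<open>A permutation that preserves \<open>F\<close> preserves the vertex set spanned by \<open>F\<close>, so it splits into an
  automorphism of the spanned graph and a permutation of the remaining vertices.\<close>

lemma card_stabilizer_le:
  fixes F :: "nat set set"
  assumes W: "\<Union>F \<subseteq> {..<n}"
  shows "card {\<sigma>. \<sigma> permutes {..<n} \<and> (\<lambda>e. \<sigma> ` e) ` F = F}
    \<le> card (Aut (spanned F)) * fact (n - card (\<Union>F))"
proof -
  let ?W = "\<Union>F" and ?St = "{\<sigma>. \<sigma> permutes {..<n} \<and> (\<lambda>e. \<sigma> ` e) ` F = F}"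
  define r where "r = (\<lambda>(\<sigma>::nat \<Rightarrow> nat). (\<lambda>x. if x \<in> ?W then \<sigma> x else x, \<lambda>x. if x \<in> ?W then x else \<sigma> x))"
  have fW: "finite ?W" by (rule finite_subset[OF W]) simp
  have "inj_on r ?St"
  proof (rule inj_onI, rule ext)
    fix \<sigma> \<rho> x assume "r \<sigma> = r \<rho>"
    then show "\<sigma> x = \<rho> x"
      by (cases "x \<in> ?W") (auto simp: r_def fun_eq_iff split: if_splits)
  qed
  moreover have "r ` ?St \<subseteq> Aut (spanned F) \<times> {\<pi>. \<pi> permutes {..<n} - ?W}"
  proof (rule image_subsetI)
    fix \<sigma> assume "\<sigma> \<in> ?St"
    then have p: "\<sigma> permutes {..<n}" and F: "(\<lambda>e. \<sigma> ` e) ` F = F" by auto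
    have "\<sigma> ` ?W = ?W" using F by (metis image_Union)
    then have b1: "bij_betw \<sigma> ?W ?W"
      using permutes_inj[OF p] by (auto simp: bij_betw_def intro: inj_on_subset)
    then have "bij_betw \<sigma> ({..<n} - ?W) ({..<n} - ?W)"
      using permutes_imp_bij[OF p] W permutes_inj[OF p] \<open>\<sigma> ` ?W = ?W\<close>
      by (auto simp: bij_betw_def image_set_diff intro: inj_on_subset)
    then have "bij_betw (\<lambda>x. if x \<in> ?W then x else \<sigma> x) ({..<n} - ?W) ({..<n} - ?W)"
      by (rule bij_betw_cong[THEN iffD1, rotated]) simp
    then have "(\<lambda>x. if x \<in> ?W then x else \<sigma> x) permutes {..<n} - ?W"
      by (rule bij_imp_permutes) (use p in \<open>auto simp: permutes_def\<close>)
    moreover have "bij_betw (\<lambda>x. if x \<in> ?W then \<sigma> x else x) ?W ?W"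
      by (rule bij_betw_cong[THEN iffD1, OF _ b1]) simp
    then have "(\<lambda>x. if x \<in> ?W then \<sigma> x else x) permutes ?W"
      by (rule bij_imp_permutes) simp
    moreover have "(\<lambda>e. (\<lambda>x. if x \<in> ?W then \<sigma> x else x) ` e) ` F = F"
    proof -
      have "(\<lambda>x. if x \<in> ?W then \<sigma> x else x) ` e = \<sigma> ` e" if "e \<in> F" for e
        using that by (intro image_cong) auto
      then show ?thesis using F by auto
    qed
    ultimately show "r \<sigma> \<in> Aut (spanned F) \<times> {\<pi>. \<pi> permutes {..<n} - ?W}"
      by (simp add: r_def Aut_def spanned_def)
  qed
  moreover have "finite (Aut (spanned F))"
    by (rule finite_subset[OF _ finite_permutations[OF fW]]) (auto simp: Aut_def spanned_def)
  ultimately have "card ?St \<le> card (Aut (spanned F) \<times> {\<pi>. \<pi> permutes {..<n} - ?W})"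
    by (intro card_inj_on_le) (auto intro: finite_permutations)
  also have "\<dots> = card (Aut (spanned F)) * fact (n - card ?W)"
    using W fW by (simp add: card_cartesian_product card_permutations card_Diff_subset)
  finally show ?thesis .
qed

text \<open>If some permutation takes \<open>F\<close> to \<open>E\<close>, all that do so form a coset of the stabilizer of \<open>F\<close>.\<close>

lemma card_permutes_image_eq_le:
  fixes F :: "nat set set"
  assumes W: "\<Union>F \<subseteq> {..<n}"
  shows "card {\<sigma>. \<sigma> permutes {..<n} \<and> (\<lambda>e. \<sigma> ` e) ` F = E}
    \<le> card {\<sigma>. \<sigma> permutes {..<n} \<and> (\<lambda>e. \<sigma> ` e) ` F = F}" (is "card ?A \<le> card ?St")
proof (cases "?A = {}")
  case False
  then obtain \<rho> where \<rho>: "\<rho> permutes {..<n}" "(\<lambda>e. \<rho> ` e) ` F = E" by auto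
  have "inj_on (\<lambda>\<sigma>. inv \<rho> \<circ> \<sigma>) ?A"
    using permutes_surj[OF \<rho>(1)] by (auto intro!: inj_onI simp: fun_eq_iff) (metis surj_f_inv_f)
  moreover have "(\<lambda>\<sigma>. inv \<rho> \<circ> \<sigma>) ` ?A \<subseteq> ?St"
  proof (rule image_subsetI)
    fix \<sigma> assume "\<sigma> \<in> ?A"
    then have \<sigma>: "\<sigma> permutes {..<n}" "(\<lambda>e. \<sigma> ` e) ` F = E" by auto
    have "(\<lambda>e. (inv \<rho> \<circ> \<sigma>) ` e) ` F = (\<lambda>e. inv \<rho> ` e) ` (\<lambda>e. \<sigma> ` e) ` F"
      by (simp add: image_image image_comp[symmetric])
    also have "\<dots> = (\<lambda>e. inv \<rho> ` e) ` (\<lambda>e. \<rho> ` e) ` F" using \<sigma> \<rho> by simp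
    also have "\<dots> = F"
      using permutes_inj[OF \<rho>(1)] by (simp add: image_image)
    finally show "inv \<rho> \<circ> \<sigma> \<in> ?St"
      using permutes_compose[OF \<sigma>(1) permutes_inv[OF \<rho>(1)]] by simp
  qed
  ultimately show ?thesis
    by (rule card_inj_on_le) (auto intro: finite_subset[OF _ finite_permutations[of "{..<n}"]])
next
  case True
  then show ?thesis by (metis card.empty le0)
qed

section \<open>Copies as an orbit\<close>

lemma permutes_extending:
  assumes f: "bij_betw f A B" and sub: "A \<subseteq> S" "B \<subseteq> S" and fin: "finite S"
  obtains \<sigma> where "\<sigma> permutes S" "\<And>x. x \<in> A \<Longrightarrow> \<sigma> x = f x"
proof -
  have "finite A" "finite B" using sub fin finite_subset by auto
  then have "card (S - A) = card (S - B)"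
    using bij_betw_same_card[OF f] sub by (simp add: card_Diff_subset)
  then obtain g where g: "bij_betw g (S - A) (S - B)"
    using fin by (metis finite_Diff finite_same_card_bij)
  define \<sigma> where "\<sigma> = (\<lambda>x. if x \<in> A then f x else if x \<in> S then g x else x)"
  have "bij_betw \<sigma> (A \<union> (S - A)) (B \<union> (S - B))"
  proof (rule bij_betw_combine)
    show "bij_betw \<sigma> A B"
      by (rule bij_betw_cong[THEN iffD1, OF _ f]) (simp add: \<sigma>_def)
    show "bij_betw \<sigma> (S - A) (S - B)"
      by (rule bij_betw_cong[THEN iffD1, OF _ g]) (simp add: \<sigma>_def)
  qed auto
  then have "bij_betw \<sigma> S S" using sub by (simp add: Un_absorb1)
  then have "\<sigma> permutes S"
    by (rule bij_imp_permutes) (use sub in \<open>auto simp: \<sigma>_def\<close>)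
  then show thesis by (rule that) (simp add: \<sigma>_def)
qed

lemma finite_subgraphs:
  assumes "simple_graph G"
  shows "finite {J. is_subgraph J G}"
proof (rule finite_subset)
  have "finite (edges G)"
    by (rule finite_subset[of _ "Pow (verts G)"]) (use assms in \<open>auto simp: simple_graph_def\<close>)
  then show "finite ((\<lambda>(V, E). Graph V E) ` (Pow (verts G) \<times> Pow (edges G)))"
    using assms by (auto simp: simple_graph_def)
  show "{J. is_subgraph J G} \<subseteq> (\<lambda>(V, E). Graph V E) ` (Pow (verts G) \<times> Pow (edges G))"
  proof
    fix J assume "J \<in> {J. is_subgraph J G}"
    then show "J \<in> (\<lambda>(V, E). Graph V E) ` (Pow (verts G) \<times> Pow (edges G))"
      by (intro image_eqI[of _ _ "(verts J, edges J)"]) (auto simp: is_subgraph_def)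
  qed
qed

lemma finite_copies: "finite (copies n H)"
proof (rule finite_subset)
  show "copies n H \<subseteq> {J. is_subgraph J (complete_graph n)}" by (auto simp: copies_def)
  have "simple_graph (complete_graph n)" by (simp add: simple_graph_def complete_graph_def)
  then show "finite {J. is_subgraph J (complete_graph n)}" by (rule finite_subgraphs)
qed

lemma finite_complete_edges [simp]: "finite (edges (complete_graph n))"
  by (rule finite_subset[of _ "Pow {..<n}"]) (auto simp: complete_graph_def)

lemma card_edges_copy:
  assumes H: "simple_graph H" and S: "S \<in> copies n H"
  shows "card (edges S) = num_edges H"
proof -
  obtain f where f: "bij_betw f (verts H) (verts S)" "(\<lambda>e. f ` e) ` edges H = edges S"
    using S by (auto simp: copies_def isomorphic_def)
  have "inj_on (\<lambda>e. f ` e) (edges H)"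
    by (rule inj_on_subset[OF inj_on_image_Pow[of f "verts H"]])
       (use f(1) H in \<open>auto simp: bij_betw_def simple_graph_def\<close>)
  then show ?thesis using f(2) card_image by metis
qed

lemma edges_copy_subset: "S \<in> copies n H \<Longrightarrow> edges S \<subseteq> edges (complete_graph n)"
  by (simp add: copies_def is_subgraph_def)

lemma finite_edges_copy: "S \<in> copies n H \<Longrightarrow> finite (edges S)"
  using edges_copy_subset finite_complete_edges finite_subset by metis

lemma copies_nonempty:
  assumes H: "simple_graph H" and v: "num_verts H \<le> n"
  shows "copies n H \<noteq> {}"
proof -
  have fin: "finite (verts H)" using H by (simp add: simple_graph_def)
  then obtain f where f: "f ` verts H \<subseteq> {..<n}" "inj_on f (verts H)"
    using card_le_inj[of "verts H" "{..<n}"] v by auto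
  have edge: "f ` e \<subseteq> f ` verts H \<and> card (f ` e) = 2" if "e \<in> edges H" for e
  proof -
    have "e \<subseteq> verts H" "card e = 2" using that H by (auto simp: simple_graph_def)
    then show ?thesis using f(2) by (metis card_image image_mono inj_on_subset)
  qed
  then have "f x < n" if "e \<in> edges H" "x \<in> e" for e x using that f(1) by blast
  with edge have "is_subgraph (relabel f H) (complete_graph n)"
    using fin f(1) by (auto simp: is_subgraph_def simple_graph_def complete_graph_def)
  moreover have "isomorphic H (relabel f H)"
    unfolding isomorphic_def using f(2) by (auto simp: bij_betw_def)
  ultimately show ?thesis by (auto simp: copies_def)
qed

lemma relabel_in_copies:
  assumes S: "S \<in> copies n H" and \<sigma>: "\<sigma> permutes {..<n}"
  shows "relabel \<sigma> S \<in> copies n H"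
proof -
  have vs: "verts S \<subseteq> {..<n}" and es: "edges S \<subseteq> {e. e \<subseteq> verts S \<and> card e = 2}"
    and fin: "finite (verts S)"
    using S by (auto simp: copies_def is_subgraph_def complete_graph_def simple_graph_def)
  obtain f where f: "bij_betw f (verts H) (verts S)" "(\<lambda>e. f ` e) ` edges H = edges S"
    using S by (auto simp: copies_def isomorphic_def)
  have vs': "\<sigma> ` verts S \<subseteq> {..<n}" using vs permutes_image[OF \<sigma>] by blast
  have card_e: "card (\<sigma> ` e) = card e" for e
    using permutes_inj[OF \<sigma>] by (intro card_image) (auto intro: inj_on_subset)
  have "bij_betw \<sigma> (verts S) (\<sigma> ` verts S)"
    using permutes_inj[OF \<sigma>] by (auto simp: bij_betw_def intro: inj_on_subset)
  then have "bij_betw (\<sigma> \<circ> f) (verts H) (\<sigma> ` verts S)" using f(1) bij_betw_trans by blast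
  moreover have "(\<lambda>e. (\<sigma> \<circ> f) ` e) ` edges H = (\<lambda>e. \<sigma> ` e) ` edges S"
    by (simp add: f(2)[symmetric] image_image image_comp[symmetric])
  ultimately have "isomorphic H (relabel \<sigma> S)"
    unfolding isomorphic_def by (intro exI[of _ "\<sigma> \<circ> f"]) simp
  moreover have "is_subgraph (relabel \<sigma> S) (complete_graph n)"
    unfolding is_subgraph_def simple_graph_def complete_graph_def relabel_sel graph.sel
    using fin vs' es card_e by fastforce
  ultimately show ?thesis by (simp add: copies_def)
qed

lemma copies_transitive:
  assumes H: "simple_graph H" and S: "S \<in> copies n H" and S': "S' \<in> copies n H"
  obtains \<sigma> where "\<sigma> permutes {..<n}" "relabel \<sigma> S = S'"
proof -
  obtain f where f: "bij_betw f (verts H) (verts S)" "(\<lambda>e. f ` e) ` edges H = edges S"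
    using S by (auto simp: copies_def isomorphic_def)
  obtain f' where f': "bij_betw f' (verts H) (verts S')" "(\<lambda>e. f' ` e) ` edges H = edges S'"
    using S' by (auto simp: copies_def isomorphic_def)
  have vs: "verts S \<subseteq> {..<n}" "verts S' \<subseteq> {..<n}"
    using S S' by (auto simp: copies_def is_subgraph_def complete_graph_def)
  have "bij_betw (f' \<circ> inv_into (verts H) f) (verts S) (verts S')"
    using bij_betw_inv_into[OF f(1)] f'(1) bij_betw_trans by blast
  then obtain \<sigma> where \<sigma>: "\<sigma> permutes {..<n}"
    and \<sigma>_eq: "\<And>x. x \<in> verts S \<Longrightarrow> \<sigma> x = (f' \<circ> inv_into (verts H) f) x"
    by (rule permutes_extending[OF _ vs]) auto
  have \<sigma>f: "\<sigma> (f x) = f' x" if "x \<in> verts H" for x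
  proof -
    have "f x \<in> verts S" using that f(1) by (auto simp: bij_betw_def)
    then show ?thesis using that f(1) \<sigma>_eq by (simp add: bij_betw_def inv_into_f_f)
  qed
  have "\<sigma> ` f ` verts H = f' ` verts H" using \<sigma>f by (simp add: image_image)
  then have "\<sigma> ` verts S = verts S'" using f(1) f'(1) by (simp add: bij_betw_def)
  moreover have "(\<lambda>e. \<sigma> ` e) ` edges S = edges S'"
  proof -
    have "\<sigma> ` f ` e = f' ` e" if "e \<in> edges H" for e
      using that H \<sigma>f by (auto simp: simple_graph_def image_image intro!: image_cong)
    then show ?thesis unfolding f(2)[symmetric] f'(2)[symmetric] by (simp add: image_image)
  qed
  ultimately have "relabel \<sigma> S = S'" by (intro graph.expand) simp
  then show thesis using \<sigma> that by blast
qed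

text \<open>The symmetric group acts transitively on the copies and all fibres of \<open>\<sigma> \<mapsto> \<sigma> S\<close> have the same size.
  Hence the image of a fixed copy under a uniform permutation is a uniform copy.\<close>

lemma card_copies_via_permutations:
  assumes H: "simple_graph H" and S: "S \<in> copies n H"
  shows "card {\<sigma>. \<sigma> permutes {..<n} \<and> P (relabel \<sigma> S)} * card (copies n H)
    = fact n * card {S' \<in> copies n H. P S'}"
proof -
  define fib where "fib = (\<lambda>S'. {\<sigma>. \<sigma> permutes {..<n} \<and> relabel \<sigma> S = S'})"
  have fin: "finite (fib S')" for S'
    by (rule finite_subset[OF _ finite_permutations[of "{..<n}"]]) (auto simp: fib_def)
  have const: "card (fib S') = card (fib S)" if S': "S' \<in> copies n H" for S'
  proof -
    obtain \<rho> where \<rho>: "\<rho> permutes {..<n}" "relabel \<rho> S = S'"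
      using copies_transitive[OF H S S'] by blast
    have "bij_betw (\<lambda>\<sigma>. \<rho> \<circ> \<sigma>) (fib S) (fib S')"
    proof (rule bij_betw_byWitness[where f' = "\<lambda>\<sigma>. inv \<rho> \<circ> \<sigma>"])
      show "\<forall>\<sigma>\<in>fib S. inv \<rho> \<circ> (\<rho> \<circ> \<sigma>) = \<sigma>" "\<forall>\<sigma>\<in>fib S'. \<rho> \<circ> (inv \<rho> \<circ> \<sigma>) = \<sigma>"
        using permutes_inv_o[OF \<rho>(1)] by (simp_all flip: comp_assoc)
      show "(\<lambda>\<sigma>. \<rho> \<circ> \<sigma>) ` fib S \<subseteq> fib S'"
        using \<rho> by (auto simp: fib_def permutes_compose relabel_comp)
      have "relabel (inv \<rho>) S' = S"
        using permutes_inv_o(2)[OF \<rho>(1)] by (simp add: \<rho>(2)[symmetric] flip: relabel_comp)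
      then show "(\<lambda>\<sigma>. inv \<rho> \<circ> \<sigma>) ` fib S' \<subseteq> fib S"
        using permutes_inv[OF \<rho>(1)]
        by (auto simp: fib_def permutes_compose relabel_comp)
    qed
    then show ?thesis by (simp add: bij_betw_same_card)
  qed
  have count: "card {\<sigma>. \<sigma> permutes {..<n} \<and> Q (relabel \<sigma> S)}
      = card {S' \<in> copies n H. Q S'} * card (fib S)" for Q
  proof -
    have "{\<sigma>. \<sigma> permutes {..<n} \<and> Q (relabel \<sigma> S)} = (\<Union>S'\<in>{S' \<in> copies n H. Q S'}. fib S')"
      using relabel_in_copies[OF S] by (auto simp: fib_def)
    also have "card \<dots> = (\<Sum>S'\<in>{S' \<in> copies n H. Q S'}. card (fib S'))"
      using fin finite_copies[of n H] by (intro card_UN_disjoint) (auto simp: fib_def)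
    also have "\<dots> = card {S' \<in> copies n H. Q S'} * card (fib S)" by (simp add: const)
    finally show ?thesis .
  qed
  have "fact n = card {\<sigma>. \<sigma> permutes {..<n}}" by (simp add: card_permutations)
  also have "\<dots> = card (copies n H) * card (fib S)" using count[of "\<lambda>_. True"] by simp
  finally show ?thesis using count[of P] by simp
qed

section \<open>The first moment threshold and the spread of copies\<close>

lemma card_Aut_pos:
  assumes "finite (verts G)" shows "card (Aut G) > 0"
proof -
  have "finite (Aut G)"
    by (rule finite_subset[OF _ finite_permutations[OF assms]]) (auto simp: Aut_def)
  moreover have "id \<in> Aut G" by (simp add: Aut_def)
  ultimately show ?thesis by (auto simp: card_gt_0_iff)
qed

lemma num_copies_pos:
  assumes "simple_graph J" shows "num_copies n J > 0"
  using card_Aut_pos[of J] assms by (simp add: num_copies_def simple_graph_def)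

lemma p_1M_le_psi:
  assumes "simple_graph H" "is_subgraph J H" "real (num_edges J) \<ge> max 1 (q * real (num_edges H))"
  shows "p_1M n J \<le> psi n q H"
  unfolding psi_def
proof (rule Max_ge)
  show "finite {p_1M n J |J. is_subgraph J H \<and> max 1 (q * real (num_edges H)) \<le> real (num_edges J)}"
    by (rule finite_subset[OF _ finite_imageI[OF finite_subgraphs[OF assms(1)], of "p_1M n"]]) auto
qed (use assms in blast)

lemma psi_pos:
  assumes "simple_graph H" "num_edges H \<ge> 1" "q \<le> 1"
  shows "psi n q H > 0"
proof -
  have "p_1M n H \<le> psi n q H"
    by (rule p_1M_le_psi) (use assms in \<open>auto simp: is_subgraph_def mult_le_cancel_right1\<close>)
  moreover have "p_1M n H > 0" using num_copies_pos[OF assms(1), of n] by (simp add: p_1M_def)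
  ultimately show ?thesis by simp
qed

lemma inverse_num_copies_le_psi_power:
  assumes H: "simple_graph H" and J: "is_subgraph J H"
    and k: "real (num_edges J) \<ge> max 1 (q * real (num_edges H))"
  shows "1 / num_copies n J \<le> psi n q H ^ num_edges J"
proof -
  let ?k = "num_edges J"
  have M: "num_copies n J > 0" using J num_copies_pos by (auto simp: is_subgraph_def)
  have "p_1M n J ^ ?k = num_copies n J powr (- 1 / real ?k * real ?k)"
    using M by (simp add: p_1M_def powr_powr flip: powr_realpow)
  also have "\<dots> = 1 / num_copies n J"
    using k M by (simp add: powr_minus_divide)
  finally have "1 / num_copies n J = p_1M n J ^ ?k" ..
  also have "\<dots> \<le> psi n q H ^ ?k"
    by (rule power_mono[OF p_1M_le_psi[OF H J k]]) (simp add: p_1M_def)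
  finally show ?thesis .
qed

text \<open>A uniform permutation moves \<open>F\<close> onto \<open>E\<close> with probability at most \<open>1 / M\<^sub>J\<close>, where \<open>J\<close> is the graph
  spanned by the edges of \<open>H\<close> that correspond to \<open>F\<close>: the stabilizer has at most
  \<open>|Aut J| (n - v(J))!\<close> elements.\<close>

lemma card_permutes_to_edge_set_le:
  assumes H: "simple_graph H" and S: "S \<in> copies n H"
    and F: "F \<subseteq> edges S" and k: "real (card F) \<ge> max 1 (q * real (num_edges H))"
  shows "real (card {\<sigma>. \<sigma> permutes {..<n} \<and> (\<lambda>e. \<sigma> ` e) ` F = E}) \<le> fact n * psi n q H ^ card F"
proof -
  obtain f where f: "bij_betw f (verts H) (verts S)" "(\<lambda>e. f ` e) ` edges H = edges S"
    using S by (auto simp: copies_def isomorphic_def)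
  have He: "e \<subseteq> verts H" "card e = 2" if "e \<in> edges H" for e
    using H that by (auto simp: simple_graph_def)
  define F' where "F' = {e \<in> edges H. f ` e \<in> F}"
  have img: "(\<lambda>e. f ` e) ` F' = F"
  proof
    show "F \<subseteq> (\<lambda>e. f ` e) ` F'"
    proof
      fix x assume x: "x \<in> F"
      then have "x \<in> (\<lambda>e. f ` e) ` edges H" using F f(2) by auto
      then show "x \<in> (\<lambda>e. f ` e) ` F'" using x by (auto simp: F'_def)
    qed
  qed (auto simp: F'_def)
  have W'V: "\<Union>F' \<subseteq> verts H" using He(1) by (auto simp: F'_def)
  have fW': "finite (\<Union>F')" using W'V H by (auto simp: simple_graph_def intro: finite_subset)
  have inj: "inj_on f (verts H)" using f(1) by (simp add: bij_betw_def)
  have W: "f ` \<Union>F' = \<Union>F" using img by (metis image_Union)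
  have bij: "bij_betw f (\<Union>F') (\<Union>F)"
    using W inj W'V by (auto simp: bij_betw_def intro: inj_on_subset)
  have card_W: "card (\<Union>F') = card (\<Union>F)" using bij by (rule bij_betw_same_card)
  have "inj_on (\<lambda>e. f ` e) F'"
    by (rule inj_on_subset[OF inj_on_image_Pow[OF inj]]) (use He(1) F'_def in auto)
  then have card_F: "card F' = card F" using img card_image by metis
  have sub: "is_subgraph (spanned F') H"
    using W'V fW' He by (auto simp: is_subgraph_def spanned_def simple_graph_def F'_def)
  have WS: "\<Union>F \<subseteq> {..<n}"
    using F S by (fastforce simp: copies_def is_subgraph_def complete_graph_def)
  have "card {\<sigma>. \<sigma> permutes {..<n} \<and> (\<lambda>e. \<sigma> ` e) ` F = E}
      \<le> card (Aut (spanned F)) * fact (n - card (\<Union>F))"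
    using card_permutes_image_eq_le[OF WS] card_stabilizer_le[OF WS] by (rule order_trans)
  also have "\<dots> \<le> card (Aut (spanned F')) * fact (n - card (\<Union>F))"
    by (intro mult_right_mono card_Aut_le[of f])
       (use bij img fW' in \<open>auto simp: spanned_def\<close>)
  finally have "real (card {\<sigma>. \<sigma> permutes {..<n} \<and> (\<lambda>e. \<sigma> ` e) ` F = E})
      \<le> card (Aut (spanned F')) * fact (n - card (\<Union>F))"
    by (rule of_nat_mono[THEN order_trans]) simp
  also have "\<dots> = fact n * (1 / num_copies n (spanned F'))"
    by (simp add: num_copies_def spanned_def card_W)
  also have "\<dots> \<le> fact n * psi n q H ^ card F"
    using inverse_num_copies_le_psi_power[OF H sub, of q n] k
    by (intro mult_left_mono) (auto simp: spanned_def card_F)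
  finally show ?thesis .
qed

text \<open>If a permuted copy of \<open>H\<close> contains \<open>E\<close>, then one of its \<open>card E\<close>-edge subgraphs was moved onto \<open>E\<close>;
  the binomial coefficient is the union bound over these subgraphs.\<close>

lemma copies_spread:
  assumes H: "simple_graph H"
    and k: "real (card E) \<ge> max 1 (q * real (num_edges H))"
  shows "real (card {S \<in> copies n H. E \<subseteq> edges S})
    \<le> (num_edges H choose card E) * psi n q H ^ card E * card (copies n H)"
proof (cases "copies n H = {}")
  case False
  then obtain S where S: "S \<in> copies n H" by blast
  let ?k = "card E"
  let ?Fs = "{F. F \<subseteq> edges S \<and> card F = ?k}"
  let ?to = "\<lambda>F. {\<sigma>. \<sigma> permutes {..<n} \<and> (\<lambda>e. \<sigma> ` e) ` F = E}"
  have finS: "finite (edges S)" and cardS: "card (edges S) = num_edges H"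
    using finite_edges_copy[OF S] card_edges_copy[OF H S] by auto
  have "{\<sigma>. \<sigma> permutes {..<n} \<and> E \<subseteq> edges (relabel \<sigma> S)} \<subseteq> (\<Union>F\<in>?Fs. ?to F)"
  proof
    fix \<sigma> assume "\<sigma> \<in> {\<sigma>. \<sigma> permutes {..<n} \<and> E \<subseteq> edges (relabel \<sigma> S)}"
    then have \<sigma>: "\<sigma> permutes {..<n}" and E: "E \<subseteq> (\<lambda>e. \<sigma> ` e) ` edges S"
      by auto
    then obtain F where F: "F \<subseteq> edges S" "E = (\<lambda>e. \<sigma> ` e) ` F" by (auto simp: subset_image_iff)
    have "inj_on (\<lambda>e. \<sigma> ` e) F"
      using permutes_inj[OF \<sigma>] by (auto intro: inj_onI simp: inj_image_eq_iff)
    then have "card F = ?k" using F(2) by (simp add: card_image)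
    then show "\<sigma> \<in> (\<Union>F\<in>?Fs. ?to F)" using \<sigma> F by blast
  qed
  then have "card {\<sigma>. \<sigma> permutes {..<n} \<and> E \<subseteq> edges (relabel \<sigma> S)} \<le> card (\<Union>F\<in>?Fs. ?to F)"
    by (rule card_mono[rotated])
       (use finS in \<open>auto intro!: finite_subset[OF _ finite_permutations[of "{..<n}"]]\<close>)
  also have "\<dots> \<le> (\<Sum>F\<in>?Fs. card (?to F))"
    by (rule card_UN_le) (use finS in auto)
  finally have "real (card {\<sigma>. \<sigma> permutes {..<n} \<and> E \<subseteq> edges (relabel \<sigma> S)})
      \<le> real (\<Sum>F\<in>?Fs. card (?to F))"
    by (rule of_nat_mono)
  also have "\<dots> = (\<Sum>F\<in>?Fs. real (card (?to F)))" by (rule of_nat_sum)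
  also have "\<dots> \<le> (\<Sum>F\<in>?Fs. fact n * psi n q H ^ ?k)"
  proof (rule sum_mono)
    fix F assume "F \<in> ?Fs"
    then have F: "F \<subseteq> edges S" "card F = ?k" by auto
    show "real (card (?to F)) \<le> fact n * psi n q H ^ ?k"
      using card_permutes_to_edge_set_le[OF H S F(1), of q E] k unfolding F(2) by simp
  qed
  also have "\<dots> = (num_edges H choose ?k) * (fact n * psi n q H ^ ?k)"
    using n_subsets[OF finS, of ?k] cardS by simp
  finally have le: "real (card {\<sigma>. \<sigma> permutes {..<n} \<and> E \<subseteq> edges (relabel \<sigma> S)})
    \<le> (num_edges H choose ?k) * (fact n * psi n q H ^ ?k)" .
  have "fact n * real (card {S \<in> copies n H. E \<subseteq> edges S})
      = real (card {\<sigma>. \<sigma> permutes {..<n} \<and> E \<subseteq> edges (relabel \<sigma> S)}) * real (card (copies n H))"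
    using arg_cong[OF card_copies_via_permutations[OF H S, of "\<lambda>S. E \<subseteq> edges S"], of real]
    by (simp only: of_nat_mult of_nat_fact)
  also have "\<dots> \<le> (num_edges H choose ?k) * (fact n * psi n q H ^ ?k) * card (copies n H)"
    using le by (rule mult_right_mono) simp
  also have "\<dots> = fact n * ((num_edges H choose ?k) * psi n q H ^ ?k * card (copies n H))" by simp
  finally show ?thesis by (simp del: binomial_eq_0_iff)
qed simp

section \<open>Joint law of the planted and the observed graph\<close>

text \<open>Edges are independent, so every event that restricts each edge separately has a product
  probability. The point masses, the superset events and the events \<open>s \<union> G = y\<close> below are all of
  this kind.\<close>

lemma prob_gnp_Pi:
  "measure_pmf.prob (gnp n p) {G. \<forall>e\<in>edges (complete_graph n). (e \<in> G) \<in> B e}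
    = (\<Prod>e\<in>edges (complete_graph n). measure_pmf.prob (bernoulli_pmf p) (B e))"
proof -
  let ?X = "edges (complete_graph n)"
  have "measure_pmf.prob (gnp n p) {G. \<forall>e\<in>?X. (e \<in> G) \<in> B e}
      = measure_pmf.prob (Pi_pmf ?X False (\<lambda>_. bernoulli_pmf p)) (Pi ?X B)"
    by (auto simp: gnp_def intro!: arg_cong[where f = "measure_pmf.prob _"])
  then show ?thesis by (simp add: measure_Pi_pmf_Pi)
qed

lemma set_pmf_gnp: "set_pmf (gnp n p) \<subseteq> Pow (edges (complete_graph n))"
  by (auto simp: gnp_def)

lemma pmf_gnp:
  assumes "y \<subseteq> edges (complete_graph n)"
  shows "pmf (gnp n p) y = (\<Prod>e\<in>edges (complete_graph n). pmf (bernoulli_pmf p) (e \<in> y))"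
proof -
  let ?X = "edges (complete_graph n)"
  have "pmf (gnp n p) y = measure_pmf.prob (gnp n p) {G. \<forall>e\<in>?X. (e \<in> G) \<in> {e \<in> y}}"
    unfolding measure_pmf_single[symmetric]
  proof (rule measure_pmf.finite_measure_eq_AE)
    show "AE G in measure_pmf (gnp n p). (G \<in> {y}) = (G \<in> {G. \<forall>e\<in>?X. (e \<in> G) \<in> {e \<in> y}})"
      using set_pmf_gnp[of n p] assms by (auto simp: AE_measure_pmf_iff)
  qed simp_all
  then show ?thesis using prob_gnp_Pi[where B = "\<lambda>e. {e \<in> y}"] by (simp add: measure_pmf_single)
qed

lemma prob_gnp_superset:
  assumes p: "p \<in> {0..1}" and A: "A \<subseteq> edges (complete_graph n)"
  shows "measure_pmf.prob (gnp n p) {G. A \<subseteq> G} = p ^ card A"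
proof -
  let ?X = "edges (complete_graph n)"
  have "{G. A \<subseteq> G} = {G. \<forall>e\<in>?X. (e \<in> G) \<in> (if e \<in> A then {True} else UNIV)}"
    using A by auto
  then have "measure_pmf.prob (gnp n p) {G. A \<subseteq> G}
      = (\<Prod>e\<in>?X. if e \<in> A then p else 1)"
    using prob_gnp_Pi[where B = "\<lambda>e. if e \<in> A then {True} else UNIV"] p
    by (simp add: if_distrib[of "measure_pmf.prob _"] measure_pmf_single cong: if_cong)
  also have "\<dots> = p ^ card A"
    using A by (simp add: prod.If_cases Int_absorb1)
  finally show ?thesis .
qed

text \<open>Bayes' rule for the planted model. Edges of \<open>s\<close> are unconstrained on the left but cost \<open>p\<close> each
  on the right, so the likelihood of \<open>y\<close> depends on \<open>s \<subseteq> y\<close> only through its size. This makes the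
  posterior uniform.\<close>

lemma prob_gnp_union_eq:
  assumes p: "p \<in> {0..1}" and s: "s \<subseteq> y" and y: "y \<subseteq> edges (complete_graph n)"
  shows "p ^ card s * measure_pmf.prob (gnp n p) {G. s \<union> G = y} = pmf (gnp n p) y"
proof -
  let ?X = "edges (complete_graph n)"
  let ?B = "\<lambda>e. if e \<in> s then UNIV else {e \<in> y}"
  have "measure_pmf.prob (gnp n p) {G. s \<union> G = y}
      = measure_pmf.prob (gnp n p) {G. \<forall>e\<in>?X. (e \<in> G) \<in> ?B e}"
  proof (rule measure_pmf.finite_measure_eq_AE)
    show "AE G in measure_pmf (gnp n p). (G \<in> {G. s \<union> G = y}) = (G \<in> {G. \<forall>e\<in>?X. (e \<in> G) \<in> ?B e})"
    proof (rule AE_pmfI)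
      fix G assume "G \<in> set_pmf (gnp n p)"
      then have "G \<subseteq> ?X" using set_pmf_gnp[of n p] by blast
      then show "(G \<in> {G. s \<union> G = y}) = (G \<in> {G. \<forall>e\<in>?X. (e \<in> G) \<in> ?B e})"
        using s y by (fastforce split: if_splits)
    qed
  qed simp_all
  also have "\<dots> = (\<Prod>e\<in>?X. if e \<in> s then 1 else pmf (bernoulli_pmf p) (e \<in> y))"
    using prob_gnp_Pi[where B = ?B]
    by (simp add: if_distrib[of "measure_pmf.prob _"] measure_pmf_single cong: if_cong)
  finally have "p ^ card s * measure_pmf.prob (gnp n p) {G. s \<union> G = y}
      = (\<Prod>e\<in>?X. if e \<in> s then p else 1) * (\<Prod>e\<in>?X. if e \<in> s then 1 else pmf (bernoulli_pmf p) (e \<in> y))"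
    using s y by (simp add: prod.If_cases Int_absorb1)
  also have "\<dots> = (\<Prod>e\<in>?X. pmf (bernoulli_pmf p) (e \<in> y))"
    unfolding prod.distrib[symmetric] using s p by (intro prod.cong) auto
  finally show ?thesis using pmf_gnp[OF y] by simp
qed

definition contained :: "nat \<Rightarrow> 'a graph \<Rightarrow> nat set set \<Rightarrow> nat graph set" where
  "contained n H y = {S \<in> copies n H. edges S \<subseteq> y}"

lemma finite_set_planted_model:
  assumes "copies n H \<noteq> {}"
  shows "finite (set_pmf (planted_model n H p))"
proof -
  have "finite (set_pmf (gnp n p))" by (rule finite_subset[OF set_pmf_gnp]) simp
  then show ?thesis using assms by (simp add: planted_model_def finite_copies)
qed

text \<open>Change of measure to \<open>G(n,p)\<close>: conditionally on the observation \<open>y\<close>, each contained copy has the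
  same weight.\<close>

lemma expectation_planted_model:
  fixes \<phi> :: "nat graph \<Rightarrow> nat set set \<Rightarrow> real" and p :: real
  assumes H: "simple_graph H" and ne: "copies n H \<noteq> {}" and p: "p \<in> {0<..1}"
  shows "measure_pmf.expectation (planted_model n H p) (\<lambda>\<omega>. \<phi> (fst \<omega>) (observed \<omega>))
    = (\<Sum>y\<in>Pow (edges (complete_graph n)). pmf (gnp n p) y / (card (copies n H) * p ^ num_edges H)
         * (\<Sum>S\<in>contained n H y. \<phi> S y))" (is "?L = ?R")
proof -
  let ?X = "edges (complete_graph n)" and ?C = "copies n H" and ?h = "num_edges H"
  let ?M = "real (card (copies n H))"
  have fin: "finite ?C" by (rule finite_copies)
  have union: "(\<Sum>G\<in>Pow ?X. \<phi> S (edges S \<union> G) * pmf (gnp n p) G)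
      = (\<Sum>y\<in>Pow ?X. (if edges S \<subseteq> y then pmf (gnp n p) y / p ^ ?h * \<phi> S y else 0))"
    if S: "S \<in> ?C" for S
  proof -
    have "(\<Sum>G\<in>Pow ?X. \<phi> S (edges S \<union> G) * pmf (gnp n p) G)
        = (\<Sum>y\<in>Pow ?X. \<Sum>G\<in>{G\<in>Pow ?X. edges S \<union> G = y}. \<phi> S (edges S \<union> G) * pmf (gnp n p) G)"
      by (rule sum.group[symmetric]) (use edges_copy_subset[OF S] in auto)
    also have "\<dots> = (\<Sum>y\<in>Pow ?X. \<phi> S y * measure_pmf.prob (gnp n p) {G. edges S \<union> G = y})"
    proof (rule sum.cong[OF refl])
      fix y
      have "measure_pmf.prob (gnp n p) {G. edges S \<union> G = y}
          = measure_pmf.prob (gnp n p) {G\<in>Pow ?X. edges S \<union> G = y}"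
        by (rule measure_pmf.finite_measure_eq_AE)
           (use set_pmf_gnp[of n p] in \<open>auto simp: AE_measure_pmf_iff\<close>)
      also have "\<dots> = (\<Sum>G\<in>{G\<in>Pow ?X. edges S \<union> G = y}. pmf (gnp n p) G)"
        by (rule measure_measure_pmf_finite) simp
      finally show "(\<Sum>G\<in>{G\<in>Pow ?X. edges S \<union> G = y}. \<phi> S (edges S \<union> G) * pmf (gnp n p) G)
          = \<phi> S y * measure_pmf.prob (gnp n p) {G. edges S \<union> G = y}"
        by (simp add: sum_distrib_left)
    qed
    also have "\<dots> = (\<Sum>y\<in>Pow ?X. (if edges S \<subseteq> y then pmf (gnp n p) y / p ^ ?h * \<phi> S y else 0))"
    proof (rule sum.cong[OF refl])
      fix y assume y: "y \<in> Pow ?X"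
      show "\<phi> S y * measure_pmf.prob (gnp n p) {G. edges S \<union> G = y}
          = (if edges S \<subseteq> y then pmf (gnp n p) y / p ^ ?h * \<phi> S y else 0)"
      proof (cases "edges S \<subseteq> y")
        case True
        then show ?thesis
          using prob_gnp_union_eq[of p "edges S" y n] p y card_edges_copy[OF H S]
          by (auto simp: field_simps)
      next
        case False
        then have none: "{G. edges S \<union> G = y} = {}" by auto
        show ?thesis unfolding none using False by simp
      qed
    qed
    finally show ?thesis .
  qed
  have "?L = (\<Sum>\<omega>\<in>?C \<times> Pow ?X. \<phi> (fst \<omega>) (observed \<omega>) * pmf (planted_model n H p) \<omega>)"
    by (rule integral_measure_pmf_real)
       (use fin ne set_pmf_gnp[of n p] in \<open>auto simp: planted_model_def\<close>)
  also have "\<dots> = (\<Sum>S\<in>?C. \<Sum>G\<in>Pow ?X. \<phi> S (edges S \<union> G) * (pmf (gnp n p) G / ?M))"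
    by (subst sum.cartesian_product)
       (auto simp: planted_model_def observed_def planted_def pmf_pair pmf_of_set[OF ne fin] intro!: sum.cong)
  also have "\<dots> = (\<Sum>S\<in>?C. (\<Sum>G\<in>Pow ?X. \<phi> S (edges S \<union> G) * pmf (gnp n p) G) / ?M)"
    by (simp add: sum_divide_distrib)
  also have "\<dots> = (\<Sum>S\<in>?C. (\<Sum>y\<in>Pow ?X. (if edges S \<subseteq> y then pmf (gnp n p) y / p ^ ?h * \<phi> S y else 0)) / ?M)"
    by (intro sum.cong refl arg_cong2[where f = "(/)"] union)
  also have "\<dots> = (\<Sum>S\<in>?C. \<Sum>y\<in>Pow ?X. (if edges S \<subseteq> y then pmf (gnp n p) y / (?M * p ^ ?h) * \<phi> S y else 0))"
    by (auto simp: sum_divide_distrib field_simps intro!: sum.cong)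
  also have "\<dots> = (\<Sum>y\<in>Pow ?X. \<Sum>S\<in>?C. (if edges S \<subseteq> y then pmf (gnp n p) y / (?M * p ^ ?h) * \<phi> S y else 0))"
    by (rule sum.swap)
  also have "\<dots> = ?R"
    unfolding contained_def using fin
    by (intro sum.cong refl) (simp add: sum_distrib_left sum.inter_filter[symmetric])
  finally show ?thesis .
qed

definition inclusion_freq :: "nat \<Rightarrow> 'a graph \<Rightarrow> nat set set \<Rightarrow> nat set \<Rightarrow> real" where
  "inclusion_freq n H y e =
     (\<Sum>S\<in>contained n H y. of_bool (e \<in> edges S)) / card (contained n H y)"

lemma finite_contained: "finite (contained n H y)"
  unfolding contained_def using finite_copies[of n H] by simp

text \<open>The posterior is uniform on the contained copies, so the conditional probability of an edge is the
  fraction of these copies that use it.\<close>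

lemma real_cond_exp_planted:
  fixes p :: real
  assumes H: "simple_graph H" and ne: "copies n H \<noteq> {}" and p: "p \<in> {0<..1}"
  shows "AE \<omega> in measure_pmf (planted_model n H p).
    real_cond_exp (measure_pmf (planted_model n H p)) sigma_observed
      (\<lambda>\<omega>. of_bool (e \<in> planted \<omega>)) \<omega> = inclusion_freq n H (observed \<omega>) e"
proof -
  let ?P = "planted_model n H p"
  have sets_obs: "sets sigma_observed = {observed -` B | B. True}"
    unfolding sigma_observed_def by (subst sets_vimage_algebra2) auto
  have "subalgebra (measure_pmf ?P) sigma_observed"
    by (simp add: subalgebra_def sigma_observed_def)
  then interpret finite_measure_subalgebra "measure_pmf ?P" sigma_observed
    by unfold_locales
  have int: "integrable (measure_pmf ?P) f" for f :: "_ \<Rightarrow> real"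
    by (rule integrable_measure_pmf_finite[OF finite_set_planted_model[OF ne]])
  show ?thesis
  proof (rule real_cond_exp_charact)
    fix A assume "A \<in> sets sigma_observed"
    then obtain B where A: "A = observed -` B" by (auto simp: sets_obs)
    have mean: "(\<Sum>S\<in>contained n H y. indicator B y * of_bool (e \<in> edges S) :: real)
        = (\<Sum>S\<in>contained n H y. indicator B y * inclusion_freq n H y e)" for y
    proof (cases "contained n H y = {}")
      case False
      then have "card (contained n H y) \<noteq> 0" using finite_contained[of n H y] by simp
      then show ?thesis by (simp only: inclusion_freq_def sum_constant sum_distrib_left[symmetric]) simp
    qed simp
    have "(LINT \<omega>:A|measure_pmf ?P. of_bool (e \<in> planted \<omega>) :: real)
        = measure_pmf.expectation ?P (\<lambda>\<omega>. indicator B (observed \<omega>) * of_bool (e \<in> edges (fst \<omega>)))"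
      by (simp add: set_lebesgue_integral_def A planted_def indicator_vimage)
    also have "\<dots> = measure_pmf.expectation ?P
        (\<lambda>\<omega>. indicator B (observed \<omega>) * inclusion_freq n H (observed \<omega>) e)"
      unfolding expectation_planted_model[OF H ne p, where \<phi> = "\<lambda>S y. indicator B y * of_bool (e \<in> edges S)"]
        expectation_planted_model[OF H ne p, where \<phi> = "\<lambda>S y. indicator B y * inclusion_freq n H y e"]
      by (simp only: mean)
    also have "\<dots> = (LINT \<omega>:A|measure_pmf ?P. inclusion_freq n H (observed \<omega>) e)"
      by (simp add: set_lebesgue_integral_def A indicator_vimage)
    finally show "(LINT \<omega>:A|measure_pmf ?P. of_bool (e \<in> planted \<omega>) :: real)
      = (LINT \<omega>:A|measure_pmf ?P. inclusion_freq n H (observed \<omega>) e)" .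
  next
    have "observed \<in> sigma_observed \<rightarrow>\<^sub>M count_space UNIV"
      unfolding sigma_observed_def by (rule measurable_vimage_algebra1) simp
    then show "(\<lambda>\<omega>. inclusion_freq n H (observed \<omega>) e) \<in> borel_measurable sigma_observed"
      by (rule measurable_compose) simp
  qed (rule int)+
qed

section \<open>The mean squared error as an expected overlap\<close>

text \<open>Bias-variance decomposition: the squared deviations of the indicator vectors from their mean add
  up to the squared norms minus the total pairwise inner product divided by the size of the family.\<close>

lemma sum_sq_deviation_of_family:
  fixes ed :: "'i \<Rightarrow> 'b set"
  assumes C: "finite C" and X: "finite X" and sub: "\<And>S. S \<in> C \<Longrightarrow> ed S \<subseteq> X"
  shows "(\<Sum>S\<in>C. \<Sum>e\<in>X. (of_bool (e \<in> ed S) - (\<Sum>S'\<in>C. of_bool (e \<in> ed S')) / card C)\<^sup>2)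
    = (\<Sum>S\<in>C. real (card (ed S))) - (\<Sum>S\<in>C. \<Sum>S'\<in>C. real (card (ed S \<inter> ed S'))) / card C"
proof (cases "C = {}")
  case False
  define c where "c = real (card C)"
  have c: "c > 0" using False C by (simp add: c_def card_gt_0_iff)
  define z where "z = (\<lambda>e. \<Sum>S\<in>C. of_bool (e \<in> ed S) :: real)"
  have one: "(\<Sum>S\<in>C. (of_bool (e \<in> ed S) - z e / c)\<^sup>2) = z e - (z e)\<^sup>2 / c" for e
  proof -
    have "(\<Sum>S\<in>C. (of_bool (e \<in> ed S) - z e / c)\<^sup>2)
        = (\<Sum>S\<in>C. of_bool (e \<in> ed S) - 2 * (z e / c) * of_bool (e \<in> ed S) + (z e / c)\<^sup>2)"
      by (intro sum.cong) (auto simp: power2_diff)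
    also have "\<dots> = z e - 2 * (z e / c) * z e + c * (z e / c)\<^sup>2"
    proof -
      have "(\<Sum>S\<in>C. of_bool (e \<in> ed S)) = z e" by (simp only: z_def)
      then show ?thesis
        by (simp only: sum.distrib sum_subtractf sum_distrib_left[symmetric] sum_constant c_def)
    qed
    also have "\<dots> = z e - (z e)\<^sup>2 / c" using c by (simp add: power2_eq_square field_simps)
    finally show ?thesis .
  qed
  have card_eq: "real (card A) = (\<Sum>e\<in>X. of_bool (e \<in> A))" if "A \<subseteq> X" for A
    using that X by (simp add: Int_absorb1)
  have "(\<Sum>e\<in>X. (z e)\<^sup>2) = (\<Sum>e\<in>X. \<Sum>S\<in>C. \<Sum>S'\<in>C. of_bool (e \<in> ed S \<inter> ed S'))"
    by (simp add: z_def power2_eq_square sum_product of_bool_conj)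
  also have "\<dots> = (\<Sum>S\<in>C. \<Sum>e\<in>X. \<Sum>S'\<in>C. of_bool (e \<in> ed S \<inter> ed S'))"
    by (rule sum.swap)
  also have "\<dots> = (\<Sum>S\<in>C. \<Sum>S'\<in>C. \<Sum>e\<in>X. of_bool (e \<in> ed S \<inter> ed S'))"
    by (intro sum.cong refl sum.swap)
  also have "\<dots> = (\<Sum>S\<in>C. \<Sum>S'\<in>C. real (card (ed S \<inter> ed S')))"
    using sub by (intro sum.cong refl card_eq[symmetric]) auto
  finally have zz: "(\<Sum>e\<in>X. (z e)\<^sup>2) = (\<Sum>S\<in>C. \<Sum>S'\<in>C. real (card (ed S \<inter> ed S')))" .
  have "(\<Sum>e\<in>X. z e) = (\<Sum>S\<in>C. \<Sum>e\<in>X. of_bool (e \<in> ed S))"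
    unfolding z_def by (rule sum.swap)
  also have "\<dots> = (\<Sum>S\<in>C. real (card (ed S)))"
    using sub by (intro sum.cong refl card_eq[symmetric]) auto
  finally have z1: "(\<Sum>e\<in>X. z e) = (\<Sum>S\<in>C. real (card (ed S)))" .
  have "(\<Sum>S\<in>C. \<Sum>e\<in>X. (of_bool (e \<in> ed S) - z e / c)\<^sup>2)
      = (\<Sum>e\<in>X. \<Sum>S\<in>C. (of_bool (e \<in> ed S) - z e / c)\<^sup>2)" by (rule sum.swap)
  also have "\<dots> = (\<Sum>e\<in>X. z e) - (\<Sum>e\<in>X. (z e)\<^sup>2) / c"
    by (simp add: one sum_subtractf sum_divide_distrib)
  finally show ?thesis unfolding zz z1 by (simp add: z_def c_def)
qed simp

text \<open>The inner double sum, divided by the number of contained copies twice, is the mean overlap of two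
  posterior samples; one of the two factors is absorbed by the density of the planted law.\<close>

lemma num_edges_minus_MMSE:
  fixes p :: real
  assumes H: "simple_graph H" and ne: "copies n H \<noteq> {}" and p: "p \<in> {0<..1}"
  shows "num_edges H - MMSE n H p =
    (\<Sum>y\<in>Pow (edges (complete_graph n)). pmf (gnp n p) y / (card (copies n H) * p ^ num_edges H)
         * ((\<Sum>S\<in>contained n H y. \<Sum>S'\<in>contained n H y. real (card (edges S \<inter> edges S')))
            / card (contained n H y)))"
proof -
  let ?X = "edges (complete_graph n)" and ?P = "planted_model n H p"
  define w where "w = (\<lambda>y. pmf (gnp n p) y / (card (copies n H) * p ^ num_edges H))"
  let ?T = "\<lambda>y. \<Sum>S\<in>contained n H y. \<Sum>S'\<in>contained n H y. real (card (edges S \<inter> edges S'))"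
  let ?Z = "\<lambda>y. real (card (contained n H y))"
  have "MMSE n H p = measure_pmf.expectation ?P
     (\<lambda>\<omega>. \<Sum>e\<in>?X. (of_bool (e \<in> edges (fst \<omega>)) - inclusion_freq n H (observed \<omega>) e)\<^sup>2)"
    unfolding MMSE_def
  proof (rule integral_cong_AE)
    have "AE \<omega> in measure_pmf ?P. \<forall>e\<in>?X. real_cond_exp (measure_pmf ?P) sigma_observed
      (\<lambda>\<omega>. of_bool (e \<in> planted \<omega>)) \<omega> = inclusion_freq n H (observed \<omega>) e"
      by (rule AE_finite_allI) (simp_all add: real_cond_exp_planted[OF H ne p])
    then show "AE \<omega> in measure_pmf ?P.
      (\<Sum>e\<in>?X. (of_bool (e \<in> planted \<omega>)
         - real_cond_exp (measure_pmf ?P) sigma_observed (\<lambda>\<omega>'. of_bool (e \<in> planted \<omega>')) \<omega>)\<^sup>2)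
      = (\<Sum>e\<in>?X. (of_bool (e \<in> edges (fst \<omega>)) - inclusion_freq n H (observed \<omega>) e)\<^sup>2)"
      by eventually_elim (simp add: planted_def)
  qed simp_all
  also have "\<dots> = (\<Sum>y\<in>Pow ?X. w y *
      (\<Sum>S\<in>contained n H y. \<Sum>e\<in>?X. (of_bool (e \<in> edges S) - inclusion_freq n H y e)\<^sup>2))"
    unfolding w_def by (rule expectation_planted_model[OF H ne p])
  also have "\<dots> = (\<Sum>y\<in>Pow ?X. w y * (num_edges H * ?Z y - ?T y / ?Z y))"
  proof (intro sum.cong refl arg_cong2[where f = "(*)"])
    fix y
    have "(\<Sum>S\<in>contained n H y. \<Sum>e\<in>?X. (of_bool (e \<in> edges S) - inclusion_freq n H y e)\<^sup>2)
        = (\<Sum>S\<in>contained n H y. real (card (edges S))) - ?T y / ?Z y"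
      unfolding inclusion_freq_def
      by (rule sum_sq_deviation_of_family) (auto simp: contained_def finite_copies dest: edges_copy_subset)
    also have "(\<Sum>S\<in>contained n H y. real (card (edges S))) = num_edges H * ?Z y"
    proof -
      have "(\<Sum>S\<in>contained n H y. real (card (edges S))) = (\<Sum>S\<in>contained n H y. real (num_edges H))"
        by (rule sum.cong) (auto simp: contained_def card_edges_copy[OF H])
      then show ?thesis by simp
    qed
    finally show "(\<Sum>S\<in>contained n H y. \<Sum>e\<in>?X. (of_bool (e \<in> edges S) - inclusion_freq n H y e)\<^sup>2)
      = num_edges H * ?Z y - ?T y / ?Z y" .
  qed
  also have "\<dots> = num_edges H * (\<Sum>y\<in>Pow ?X. w y * ?Z y) - (\<Sum>y\<in>Pow ?X. w y * (?T y / ?Z y))"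
    by (simp add: right_diff_distrib sum_subtractf sum_distrib_left mult_ac)
  also have "(\<Sum>y\<in>Pow ?X. w y * ?Z y) = 1"
    using expectation_planted_model[OF H ne p, where \<phi> = "\<lambda>_ _. 1"] by (simp add: w_def)
  finally show ?thesis by (simp add: w_def)
qed

section \<open>Bounding the overlap by a truncated second moment\<close>

lemma sum_pmf_gnp: "(\<Sum>y\<in>Pow (edges (complete_graph n)). pmf (gnp n p) y) = 1"
  by (rule sum_pmf_eq_1) (use set_pmf_gnp in auto)

text \<open>The second moment of the number of contained copies under \<open>G(n,p)\<close>, relative to the squared mean
  and restricted to pairs of copies that share a proportion of at least \<open>q\<close> of their edges.\<close>

definition overlap_moment :: "nat \<Rightarrow> real \<Rightarrow> 'a graph \<Rightarrow> real \<Rightarrow> real" where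
  "overlap_moment n p H q = (\<Sum>S\<in>copies n H. \<Sum>S'\<in>copies n H.
     if q * num_edges H \<le> card (edges S \<inter> edges S') then (1 / p) ^ card (edges S \<inter> edges S') else 0)
   / (real (card (copies n H)))\<^sup>2"

definition overlapping_pairs :: "nat \<Rightarrow> 'a graph \<Rightarrow> real \<Rightarrow> nat set set \<Rightarrow> real" where
  "overlapping_pairs n H q y = (\<Sum>S\<in>contained n H y. \<Sum>S'\<in>contained n H y.
     of_bool (q * num_edges H \<le> card (edges S \<inter> edges S')))"

text \<open>Two copies with \<open>k\<close> common edges are both present with probability \<open>p\<^sup>2\<^sup>h\<^sup>-\<^sup>k\<close>.\<close>

lemma expectation_overlapping_pairs:
  fixes p :: real
  assumes H: "simple_graph H" and ne: "copies n H \<noteq> {}" and p: "p \<in> {0<..1}"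
  shows "(\<Sum>y\<in>Pow (edges (complete_graph n)). pmf (gnp n p) y * overlapping_pairs n H q y)
    = (card (copies n H) * p ^ num_edges H)\<^sup>2 * overlap_moment n p H q"
proof -
  let ?X = "edges (complete_graph n)" and ?C = "copies n H" and ?h = "num_edges H"
  let ?big = "\<lambda>S S'. q * ?h \<le> card (edges S \<inter> edges S')"
  have fin: "finite ?C" by (rule finite_copies)
  have pairs: "overlapping_pairs n H q y
      = (\<Sum>S\<in>?C. \<Sum>S'\<in>?C. of_bool (?big S S') * of_bool (edges S \<union> edges S' \<subseteq> y))" for y
  proof -
    have "overlapping_pairs n H q y = (\<Sum>S\<in>?C. if edges S \<subseteq> y then
        (\<Sum>S'\<in>?C. if edges S' \<subseteq> y then of_bool (?big S S') else 0) else 0)"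
      unfolding overlapping_pairs_def contained_def using fin by (simp only: sum.inter_filter)
    also have "\<dots> = (\<Sum>S\<in>?C. \<Sum>S'\<in>?C. of_bool (?big S S') * of_bool (edges S \<union> edges S' \<subseteq> y))"
      by (intro sum.cong refl) (auto intro!: sum.cong)
    finally show ?thesis .
  qed
  have both: "(\<Sum>y\<in>Pow ?X. pmf (gnp n p) y * of_bool (edges S \<union> edges S' \<subseteq> y))
      = (p ^ ?h)\<^sup>2 * (1 / p) ^ card (edges S \<inter> edges S')" if S: "S \<in> ?C" "S' \<in> ?C" for S S'
  proof -
    let ?U = "edges S \<union> edges S'"
    have "(\<Sum>y\<in>Pow ?X. pmf (gnp n p) y * of_bool (?U \<subseteq> y)) = (\<Sum>y\<in>Pow ?X. if ?U \<subseteq> y then pmf (gnp n p) y else 0)"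
      by (intro sum.cong) auto
    also have "\<dots> = (\<Sum>y\<in>{y\<in>Pow ?X. ?U \<subseteq> y}. pmf (gnp n p) y)"
      by (rule sum.inter_filter[symmetric]) simp
    also have "\<dots> = measure_pmf.prob (gnp n p) {y\<in>Pow ?X. ?U \<subseteq> y}"
      by (rule measure_measure_pmf_finite[symmetric]) simp
    also have "\<dots> = measure_pmf.prob (gnp n p) {y. ?U \<subseteq> y}"
      by (rule measure_pmf.finite_measure_eq_AE)
         (use set_pmf_gnp[of n p] in \<open>auto simp: AE_measure_pmf_iff\<close>)
    also have "\<dots> = p ^ card ?U"
      by (rule prob_gnp_superset) (use p S edges_copy_subset in auto)
    also have "\<dots> = (p ^ ?h)\<^sup>2 * (1 / p) ^ card (edges S \<inter> edges S')"
    proof -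
      have "card ?U + card (edges S \<inter> edges S') = ?h + ?h"
        using card_Un_Int[of "edges S" "edges S'"] S finite_edges_copy card_edges_copy[OF H] by metis
      then have "p ^ card ?U * p ^ card (edges S \<inter> edges S') = (p ^ ?h)\<^sup>2"
        by (simp add: power2_eq_square flip: power_add)
      then show ?thesis using p by (simp add: field_simps)
    qed
    finally show ?thesis .
  qed
  have "(\<Sum>y\<in>Pow ?X. pmf (gnp n p) y * overlapping_pairs n H q y)
      = (\<Sum>y\<in>Pow ?X. \<Sum>S\<in>?C. \<Sum>S'\<in>?C.
           of_bool (?big S S') * (pmf (gnp n p) y * of_bool (edges S \<union> edges S' \<subseteq> y)))"
    unfolding pairs sum_distrib_left by (simp only: mult.left_commute)
  also have "\<dots> = (\<Sum>S\<in>?C. \<Sum>y\<in>Pow ?X. \<Sum>S'\<in>?C.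
           of_bool (?big S S') * (pmf (gnp n p) y * of_bool (edges S \<union> edges S' \<subseteq> y)))"
    by (rule sum.swap)
  also have "\<dots> = (\<Sum>S\<in>?C. \<Sum>S'\<in>?C. \<Sum>y\<in>Pow ?X.
           of_bool (?big S S') * (pmf (gnp n p) y * of_bool (edges S \<union> edges S' \<subseteq> y)))"
    by (intro sum.cong refl sum.swap)
  also have "\<dots> = (\<Sum>S\<in>?C. \<Sum>S'\<in>?C. of_bool (?big S S') *
      ((p ^ ?h)\<^sup>2 * (1 / p) ^ card (edges S \<inter> edges S')))"
    by (intro sum.cong refl) (simp only: sum_distrib_left[symmetric] both)
  also have "\<dots> = (p ^ ?h)\<^sup>2 * (\<Sum>S\<in>?C. \<Sum>S'\<in>?C.
      if ?big S S' then (1 / p) ^ card (edges S \<inter> edges S') else 0)"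
    by (auto simp: sum_distrib_left intro!: sum.cong)
  also have "\<dots> = (card ?C * p ^ ?h)\<^sup>2 * overlap_moment n p H q"
    using ne fin by (simp add: overlap_moment_def power_mult_distrib)
  finally show ?thesis .
qed

lemma overlap_moment_nonneg: "p \<ge> 0 \<Longrightarrow> overlap_moment n p H q \<ge> 0"
  unfolding overlap_moment_def by (intro divide_nonneg_nonneg sum_nonneg) auto

text \<open>Overlaps below \<open>q h\<close> contribute at most \<open>q h\<close>, the others at most \<open>h\<close> each. If \<open>Z\<close> copies are
  present and \<open>B\<close> pairs of them have a large overlap, then \<open>B \<le> Z\<^sup>2\<close> gives \<open>B / Z \<le> sqrt B\<close>. This
  removes the random denominator, and Cauchy-Schwarz reduces the expectation of \<open>sqrt B\<close> to that
  of \<open>B\<close>.\<close>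

lemma num_edges_minus_MMSE_le:
  fixes p :: real
  assumes H: "simple_graph H" and ne: "copies n H \<noteq> {}" and p: "p \<in> {0<..1}" and q: "q \<ge> 0"
  shows "num_edges H - MMSE n H p \<le> num_edges H * (q + sqrt (overlap_moment n p H q))"
proof -
  let ?X = "edges (complete_graph n)" and ?h = "real (num_edges H)"
  let ?T = "\<lambda>y. \<Sum>S\<in>contained n H y. \<Sum>S'\<in>contained n H y. real (card (edges S \<inter> edges S'))"
  let ?Z = "\<lambda>y. real (card (contained n H y))"
  let ?B = "overlapping_pairs n H q" and ?P = "pmf (gnp n p)"
  define c where "c = card (copies n H) * p ^ num_edges H"
  have c: "c > 0" using ne p finite_copies[of n H] by (simp add: c_def card_gt_0_iff)
  have B0: "?B y \<ge> 0" for y unfolding overlapping_pairs_def by (intro sum_nonneg) simp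
  have BZ: "?B y \<le> ?Z y * ?Z y" for y
  proof -
    have "?B y \<le> (\<Sum>S\<in>contained n H y. \<Sum>S'\<in>contained n H y. 1)"
      unfolding overlapping_pairs_def by (intro sum_mono) simp
    then show ?thesis by simp
  qed
  have T: "?T y \<le> q * ?h * (?Z y * ?Z y) + ?h * ?B y" for y
  proof -
    have "?T y \<le> (\<Sum>S\<in>contained n H y. \<Sum>S'\<in>contained n H y.
        q * ?h + ?h * of_bool (q * num_edges H \<le> card (edges S \<inter> edges S')))"
    proof (intro sum_mono)
      fix S S' assume "S \<in> contained n H y" "S' \<in> contained n H y"
      then have S: "S \<in> copies n H" by (simp add: contained_def)
      have "card (edges S \<inter> edges S') \<le> card (edges S)"
        using finite_edges_copy[OF S] by (intro card_mono) auto
      then have "real (card (edges S \<inter> edges S')) \<le> ?h" using card_edges_copy[OF H S] by simp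
      then show "real (card (edges S \<inter> edges S'))
          \<le> q * ?h + ?h * of_bool (q * num_edges H \<le> card (edges S \<inter> edges S'))"
        using q by (auto intro: add_increasing)
    qed
    also have "\<dots> = q * ?h * (?Z y * ?Z y) + ?h * ?B y"
      unfolding overlapping_pairs_def
      by (simp only: sum.distrib sum_distrib_left sum_constant) (simp add: mult_ac)
    finally show ?thesis .
  qed
  have ratio: "?T y / ?Z y \<le> q * ?h * ?Z y + ?h * sqrt (?B y)" for y
  proof (cases "?Z y = 0")
    case False
    then have Z: "?Z y > 0" by simp
    have "sqrt (?B y) \<le> ?Z y"
      using real_sqrt_le_mono[OF BZ[of y]] by simp
    then have "sqrt (?B y) * sqrt (?B y) \<le> sqrt (?B y) * ?Z y"
      using B0[of y] by (intro mult_left_mono) auto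
    then have "?h * ?B y \<le> ?h * (sqrt (?B y) * ?Z y)"
      using B0[of y] by (intro mult_left_mono) auto
    then have "?T y \<le> (q * ?h * ?Z y + ?h * sqrt (?B y)) * ?Z y"
      using T[of y] by (simp add: algebra_simps)
    then show ?thesis using Z by (simp add: pos_divide_le_eq)
  qed (use B0 in simp)
  have "num_edges H - MMSE n H p = (\<Sum>y\<in>Pow ?X. ?P y / c * (?T y / ?Z y))"
    unfolding c_def by (rule num_edges_minus_MMSE[OF H ne p])
  also have "\<dots> \<le> (\<Sum>y\<in>Pow ?X. ?P y / c * (q * ?h * ?Z y + ?h * sqrt (?B y)))"
    using ratio c by (intro sum_mono mult_left_mono) (auto intro: divide_nonneg_pos)
  also have "\<dots> = ?h * (q * (\<Sum>y\<in>Pow ?X. ?P y / c * ?Z y) + (\<Sum>y\<in>Pow ?X. ?P y * sqrt (?B y)) / c)"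
    by (simp add: distrib_left sum.distrib sum_distrib_left sum_divide_distrib mult_ac)
  also have "(\<Sum>y\<in>Pow ?X. ?P y / c * ?Z y) = 1"
    using expectation_planted_model[OF H ne p, where \<phi> = "\<lambda>_ _. 1"] by (simp add: c_def)
  also have "(\<Sum>y\<in>Pow ?X. ?P y * sqrt (?B y)) / c \<le> sqrt (overlap_moment n p H q)"
  proof -
    have "(\<Sum>y\<in>Pow ?X. ?P y * sqrt (?B y))\<^sup>2
        = (\<Sum>y\<in>Pow ?X. sqrt (?P y) * (sqrt (?P y) * sqrt (?B y)))\<^sup>2"
      by (simp flip: mult.assoc)
    also have "\<dots> \<le> (\<Sum>y\<in>Pow ?X. (sqrt (?P y))\<^sup>2) * (\<Sum>y\<in>Pow ?X. (sqrt (?P y) * sqrt (?B y))\<^sup>2)"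
      by (rule Cauchy_Schwarz_ineq_sum)
    also have "\<dots> = (\<Sum>y\<in>Pow ?X. ?P y * ?B y)"
      using B0 by (simp add: power_mult_distrib sum_pmf_gnp)
    also have "\<dots> = c\<^sup>2 * overlap_moment n p H q"
      unfolding c_def by (rule expectation_overlapping_pairs[OF H ne p])
    finally have "(\<Sum>y\<in>Pow ?X. ?P y * sqrt (?B y)) \<le> sqrt (c\<^sup>2 * overlap_moment n p H q)"
      by (rule real_le_rsqrt)
    then show ?thesis using c by (simp add: real_sqrt_mult pos_divide_le_eq mult.commute)
  qed
  finally show ?thesis by (simp add: mult_left_mono)
qed

text \<open>For a fixed copy \<open>S\<close>, sum the spread bound over all large \<open>E \<subseteq> edges S\<close>. There are at most \<open>2\<^sup>h\<close> sets
  \<open>E\<close>, and the spread bound costs at most another \<open>2\<^sup>h\<close>. Since \<open>h \<le> m k\<close> for \<open>k = card E\<close>, the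
  factor \<open>4\<^sup>h\<close> is at most \<open>(4\<^sup>m)\<^sup>k\<close>, and as \<open>k \<ge> 1\<close> and \<open>4\<^sup>m \<psi>/p \<le> 1\<close>, one factor
  \<open>4\<^sup>m \<psi>/p\<close> remains. The proportion \<open>1/m\<close> and the parameter \<open>q\<close> of \<open>psi\<close> are decoupled: the
  latter can be chosen much smaller.\<close>

lemma overlap_moment_le:
  fixes p :: real and m :: nat
  assumes H: "simple_graph H" and v: "num_verts H \<le> n" and e: "num_edges H \<ge> 1"
    and p: "p > 0" and m: "m \<ge> 1" and q: "q \<le> 1 / m"
    and small: "4 ^ m * (psi n q H / p) \<le> 1"
  shows "overlap_moment n p H (1 / m) \<le> 4 ^ m * (psi n q H / p)"
proof -
  let ?C = "copies n H" and ?h = "num_edges H"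
  let ?M = "real (card ?C)"
  define r where "r = psi n q H / p"
  have q1: "q \<le> 1" by (rule order_trans[OF q]) (use m in simp)
  have r: "r > 0" using psi_pos[OF H e q1, of n] p by (simp add: r_def)
  have ne: "?C \<noteq> {}" by (rule copies_nonempty[OF H v])
  have M: "?M > 0" using ne finite_copies[of n H] by (simp add: card_gt_0_iff)
  have row: "(\<Sum>S'\<in>?C. if 1 / m * ?h \<le> card (edges S \<inter> edges S')
      then (1 / p) ^ card (edges S \<inter> edges S') else 0) \<le> ?M * (4 ^ m * r)" if S: "S \<in> ?C" for S
  proof -
    let ?Es = "{E \<in> Pow (edges S). 1 / m * ?h \<le> card E}"
    have finS: "finite (edges S)" by (rule finite_edges_copy[OF S])
    have finE: "finite ?Es" using finS by simp
    \<comment> \<open>The left-hand side is the part of the right-hand side with \<open>E = edges S \<inter> edges S'\<close>.\<close>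
    have "(\<Sum>S'\<in>?C. if 1 / m * ?h \<le> card (edges S \<inter> edges S')
        then (1 / p) ^ card (edges S \<inter> edges S') else 0)
      \<le> (\<Sum>S'\<in>?C. \<Sum>E\<in>?Es. (1 / p) ^ card E * of_bool (E \<subseteq> edges S'))"
    proof (rule sum_mono)
      fix S' assume "S' \<in> ?C"
      let ?I = "edges S \<inter> edges S'"
      show "(if 1 / m * ?h \<le> card ?I then (1 / p) ^ card ?I else 0)
        \<le> (\<Sum>E\<in>?Es. (1 / p) ^ card E * of_bool (E \<subseteq> edges S'))"
      proof (cases "1 / m * ?h \<le> card ?I")
        case True
        then have "?I \<in> ?Es" by auto
        then have "(1 / p) ^ card ?I * of_bool (?I \<subseteq> edges S')
            \<le> (\<Sum>E\<in>?Es. (1 / p) ^ card E * of_bool (E \<subseteq> edges S'))"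
          by (rule member_le_sum) (use p finE in auto)
        then show ?thesis using True by simp
      qed (use p in \<open>auto intro!: sum_nonneg\<close>)
    qed
    also have "\<dots> = (\<Sum>E\<in>?Es. (1 / p) ^ card E * card {S' \<in> ?C. E \<subseteq> edges S'})"
      by (subst sum.swap) (simp add: finite_copies Int_def flip: sum_distrib_left)
    also have "\<dots> \<le> (\<Sum>E\<in>?Es. ?M * (4 ^ m * r) / 2 ^ ?h)"
    proof (rule sum_mono)
      fix E assume E: "E \<in> ?Es"
      let ?k = "card E"
      have "real ?h > 0" using e by simp
      then have "0 < 1 / m * real ?h" using m by simp
      then have k1: "?k \<ge> 1" using E by (cases "card E") auto
      have "real ?h \<le> m * ?k" using E m by (auto simp: field_simps)
      then have hk: "?h \<le> m * ?k" by (simp flip: of_nat_mult)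
      have "q * ?h \<le> 1 / m * ?h" using q by (rule mult_right_mono) simp
      then have k: "real ?k \<ge> max 1 (q * ?h)" using E k1 by auto
      have choose: "real (?h choose ?k) \<le> 2 ^ ?h"
        using of_nat_mono[where 'a = real, OF binomial_le_pow2[of ?h ?k]] by simp
      have four: "(4::real) ^ ?h = 2 ^ ?h * 2 ^ ?h" by (simp flip: power_mult_distrib)
      have "real (?h choose ?k) * r ^ ?k * 2 ^ ?h \<le> 2 ^ ?h * r ^ ?k * 2 ^ ?h"
        using choose r by (intro mult_right_mono) auto
      also have "\<dots> = 4 ^ ?h * r ^ ?k" unfolding four by (simp only: mult_ac)
      also have "\<dots> \<le> 4 ^ (m * ?k) * r ^ ?k"
        using hk r by (intro mult_right_mono power_increasing) auto
      also have "\<dots> = (4 ^ m * r) ^ ?k" by (simp add: power_mult power_mult_distrib)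
      also have "\<dots> \<le> (4 ^ m * r) ^ 1"
        using small r k1 by (intro power_decreasing) (auto simp flip: r_def)
      finally have rare: "real (?h choose ?k) * r ^ ?k \<le> 4 ^ m * r / 2 ^ ?h"
        by (simp add: pos_le_divide_eq)
      have "(1 / p) ^ ?k * card {S' \<in> ?C. E \<subseteq> edges S'}
          \<le> (1 / p) ^ ?k * ((?h choose ?k) * psi n q H ^ ?k * ?M)"
        using copies_spread[OF H k] p by (intro mult_left_mono) auto
      also have "\<dots> = ?M * ((?h choose ?k) * r ^ ?k)"
        by (simp add: r_def power_divide)
      also have "\<dots> \<le> ?M * (4 ^ m * r / 2 ^ ?h)"
        using rare M by (intro mult_left_mono) auto
      finally show "(1 / p) ^ ?k * card {S' \<in> ?C. E \<subseteq> edges S'} \<le> ?M * (4 ^ m * r) / 2 ^ ?h"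
        by simp
    qed
    also have "\<dots> = card ?Es * (?M * (4 ^ m * r) / 2 ^ ?h)" by simp
    also have "\<dots> \<le> 2 ^ ?h * (?M * (4 ^ m * r) / 2 ^ ?h)"
    proof (rule mult_right_mono)
      have "card ?Es \<le> card (Pow (edges S))" using finS by (intro card_mono) auto
      also have "\<dots> = 2 ^ ?h" using finS card_edges_copy[OF H S] by (simp add: card_Pow)
      finally have "card ?Es \<le> 2 ^ ?h" .
      from of_nat_mono[where 'a = real, OF this] show "real (card ?Es) \<le> 2 ^ ?h" by simp
    qed (use M r in auto)
    finally show ?thesis by simp
  qed
  have "overlap_moment n p H (1 / m) \<le> (\<Sum>S\<in>?C. ?M * (4 ^ m * r)) / ?M\<^sup>2"
    unfolding overlap_moment_def by (intro divide_right_mono sum_mono row) auto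
  also have "\<dots> = 4 ^ m * r" using M by (simp add: power2_eq_square)
  finally show ?thesis by (simp add: r_def)
qed

section \<open>The nothing regime\<close>

theorem theorem3p15:
  fixes H :: "nat \<Rightarrow> 'a graph" and p :: "nat \<Rightarrow> real"
  assumes "\<And>n. n \<ge> 2 \<Longrightarrow> simple_graph (H n)"
    and "\<And>n. n \<ge> 2 \<Longrightarrow> num_verts (H n) \<le> n"
    and "\<And>n. n \<ge> 2 \<Longrightarrow> num_edges (H n) \<ge> 1"
    and "\<And>n. n \<ge> 2 \<Longrightarrow> p n \<in> {0..1}"
    and "Liminf (at_right (0::real))
           (\<lambda>q. liminf (\<lambda>n. ereal (p n / (psi n q (H n) / q)))) \<ge> 3"
  shows "(\<lambda>n. MMSE n (H n) (p n) / real (num_edges (H n))) \<longlonglongrightarrow> 1"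
proof (rule tendstoI)
  fix \<epsilon> :: real assume \<epsilon>: "\<epsilon> > 0"
  obtain m :: nat where m: "m \<ge> 1" "1 / m < \<epsilon> / 2"
  proof -
    obtain k where "inverse (real (Suc k)) < \<epsilon> / 2" using reals_Archimedean[of "\<epsilon> / 2"] \<epsilon> by auto
    then show thesis by (intro that[of "Suc k"]) (auto simp: field_simps)
  qed
  \<comment> \<open>The gap between 2 and 3 turns the limits inferior into strict inequalities that hold eventually.\<close>
  have "(2::ereal) < 3" by simp
  then have "2 < Liminf (at_right (0::real)) (\<lambda>q. liminf (\<lambda>n. ereal (p n / (psi n q (H n) / q))))"
    using assms(5) by (rule less_le_trans)
  then have "\<forall>\<^sub>F q in at_right (0::real). 2 < liminf (\<lambda>n. ereal (p n / (psi n q (H n) / q)))"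
    by (rule less_LiminfD)
  then obtain b where b: "b > 0"
    and lim: "\<And>q. 0 < q \<Longrightarrow> q < b \<Longrightarrow> 2 < liminf (\<lambda>n. ereal (p n / (psi n q (H n) / q)))"
    by (auto simp: eventually_at_right_field)
  \<comment> \<open>The target for \<open>4\<^sup>m \<psi>/p\<close>: its square root stays below \<open>\<epsilon>/2\<close>. The choice of \<open>q\<close> below enforces it
    through \<open>\<psi>/p \<le> q/2\<close>; the minimum with 1 serves the smallness condition of \<open>overlap_moment_le\<close>.\<close>
  define c where "c = min 1 (\<epsilon>\<^sup>2 / 8)"
  have c: "c > 0" using \<epsilon> by (simp add: c_def)
  define q where "q = min (b / 2) (min (1 / m) (2 * c / 4 ^ m))"
  have q: "0 < q" "q < b" "q \<le> 1 / m" "q \<le> 2 * c / 4 ^ m"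
    using b c m by (auto simp: q_def)
  have "\<forall>\<^sub>F n in sequentially. 2 < ereal (p n / (psi n q (H n) / q))"
    by (rule less_LiminfD[OF lim[OF q(1,2)]])
  then show "\<forall>\<^sub>F n in sequentially. dist (MMSE n (H n) (p n) / real (num_edges (H n))) 1 < \<epsilon>"
    using eventually_ge_at_top[of 2]
  proof eventually_elim
    case (elim n)
    note H = assms(1)[OF elim(2)] and v = assms(2)[OF elim(2)] and e = assms(3)[OF elim(2)]
    let ?h = "real (num_edges (H n))" and ?\<psi> = "psi n q (H n)"
    have h: "?h > 0" using e by simp
    have "q \<le> 1" by (rule order_trans[OF q(3)]) (use m(1) in simp)
    then have \<psi>: "?\<psi> > 0" by (rule psi_pos[OF H e])
    have "2 < p n / (?\<psi> / q)" using elim(1) by simp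
    then have p2: "2 * ?\<psi> < p n * q" using \<psi> q(1) by (simp add: field_simps)
    then have p0: "p n > 0" using \<psi> q(1) by (smt (verit) zero_less_mult_pos2)
    have p: "p n \<in> {0<..1}" using p0 assms(4)[OF elim(2)] by simp
    have ne: "copies n (H n) \<noteq> {}" by (rule copies_nonempty[OF H v])
    have "?\<psi> / p n \<le> q / 2" using p2 p0 by (simp add: field_simps)
    also have "\<dots> \<le> c / 4 ^ m" using q(4) by (simp add: mult.commute)
    finally have r: "4 ^ m * (?\<psi> / p n) \<le> c" by (simp add: field_simps)
    have "overlap_moment n (p n) (H n) (1 / m) \<le> 4 ^ m * (?\<psi> / p n)"
      by (rule overlap_moment_le[OF H v e p0 m(1) q(3)]) (use r in \<open>simp add: c_def\<close>)
    also have "\<dots> \<le> c" by (rule r)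
    also have "c \<le> \<epsilon>\<^sup>2 / 8" by (simp add: c_def)
    also have "\<dots> < (\<epsilon> / 2)\<^sup>2" using \<epsilon> by (simp add: power2_eq_square)
    finally have "sqrt (overlap_moment n (p n) (H n) (1 / m)) < \<epsilon> / 2"
      using \<epsilon> by (intro real_less_lsqrt overlap_moment_nonneg) (use p0 in auto)
    then have "1 / m + sqrt (overlap_moment n (p n) (H n) (1 / m)) < \<epsilon>" using m(2) by simp
    then have "?h * (1 / m + sqrt (overlap_moment n (p n) (H n) (1 / m))) < ?h * \<epsilon>"
      using h by (rule mult_strict_left_mono)
    then have upper: "?h - MMSE n (H n) (p n) < ?h * \<epsilon>"
      using num_edges_minus_MMSE_le[OF H ne p, of "1 / m"] by simp
    have lower: "?h - MMSE n (H n) (p n) \<ge> 0"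
      unfolding num_edges_minus_MMSE[OF H ne p]
      using p0 by (intro sum_nonneg mult_nonneg_nonneg divide_nonneg_nonneg) auto
    show ?case using h \<epsilon> upper lower by (simp add: dist_real_def abs_if field_simps)
  qed
qed

end
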